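(* Let $\{X_n^i\}_{1\le i\le N,\,n\ge0}$, $X_n^i=(x_n^{i,1},\dots,x_n^{i,d})\in\mathbb R^d$, be a solution of $$X_{n+1}^i=X_n^i+\lambda h\sum_{k=1}^N\psi_n^k(X_n^k-X_n^i)+\sigma\sqrt h\sum_{k=1}^N\sum_{l=1}^d\psi_n^k(x_n^{k,l}-x_n^{i,l})Z_n^l\,e_l,\qquad \psi_n^k:=\frac{e^{-\beta L(X_n^k)}}{\sum_{i=1}^Ne^{-\beta L(X_n^i)}},$$ $n=0,1,\dots$, with initial data $\{X_0^i\}$. Put $m=m(\lambda,h,\sigma):=2\lambda-\lambda^2h-\sigma^2$. (1) Suppose $\sigma>0$, $\lambda>0$, $0<h<\frac1\lambda$, and $\mathbb E|X_0^i|<\infty$ for all $i$. Then for $i,j=1,\dots,N$ and all $n\ge 0$, $$\big|\mathbb E[X_n^i-X_n^j]\big|\le e^{-\lambda nh}\big|\mathbb E[X_0^i-X_0^j]\big| .$$ (2) Suppose $\sigma>0$, $2\lambda>\sigma^2$, $0<h<\frac{2\lambda-\sigma^2}{\lambda^2}$, and $\mathbb E|X_0^i|^2<\infty$ for all $i$. Then for $i,j=1,\dots,N$ and all $n\ge0$, $$\mathbb E|X_n^i-X_n^j|^2\le e^{-nhm}\,\mathbb E|X_0^i-X_0^j|^2 .$$ (3) Suppose $\sigma>0$, $2\lambda>\sigma^2$ and $0<h<\frac{2\lambda-\sigma^2}{\lambda^2}$. Then there are (real-valued) random variables $Y_n$, $n\ge1$, such that for $i,j=1,\dots,N$ and all $n\ge1$,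 $$|X_n^i-X_n^j|\le e^{-nY_n}|X_0^i-X_0^j|\quad\text{a.s.},\qquad\text{and}\qquad \lim_{n\to\infty}Y_n=\frac{hm}2=\frac h2(2\lambda-\lambda^2h-\sigma^2)>0\quad\text{a.s.}$$
   Context: $N,d\ge1$, $\beta>0$; $L:\mathbb R^d\to\mathbb R$ is locally Lipschitz continuous; $\{e_l\}$ is the standard basis of $\mathbb R^d$; $|\cdot|$ is the Euclidean norm. The random variables $\{Z_n^l\}_{n\ge0,\,1\le l\le d}$ are i.i.d. standard normal $\mathcal N(0,1)$ (the same ones for all particles $i$), and the initial data $(X_0^1,\dots,X_0^N)$ are random vectors independent of $\{Z_n^l\}$. *)

theory Defs
  imports "HOL-Probability.Probability"
begin

text \<open>
  The library notion is for families of functions depending on a parameter;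
  a constant family over a one-point parameter set gives local Lipschitz continuity
  of a single function.
\<close>
definition locally_lipschitz :: "('a::metric_space \<Rightarrow> 'b::metric_space) \<Rightarrow> bool" where
  "locally_lipschitz f \<longleftrightarrow> local_lipschitz {0::real} UNIV (\<lambda>_. f)"

text \<open>
  Independence of two random variables with values in measurable spaces \<open>S\<close>, \<open>T\<close>, as in
  the library fact \<open>indep_var_eq\<close>; but \<open>prob_space.indep_var\<close> forces both to have
  the same codomain type, which is not the case for the initial data and the noise.
\<close>
definition indep_rv ::
  "'a measure \<Rightarrow> 'b measure \<Rightarrow> ('a \<Rightarrow> 'b) \<Rightarrow> 'c measure \<Rightarrow> ('a \<Rightarrow> 'c) \<Rightarrow> bool" where
  "indep_rv M S f T g \<longleftrightarrow>
     f \<in> measurable M S \<and> g \<in> measurable M T \<and>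
     prob_space.indep_set M
       (sigma_sets (space M) {f -` A \<inter> space M | A. A \<in> sets S})
       (sigma_sets (space M) {g -` A \<inter> space M | A. A \<in> sets T})"

text \<open>In the following, particles are indexed by \<open>{1..N}\<close> and \<open>x i\<close> is the position of particle \<open>i\<close>.\<close>

definition weight ::
  "nat \<Rightarrow> real \<Rightarrow> (real^'d \<Rightarrow> real) \<Rightarrow> (nat \<Rightarrow> real^'d) \<Rightarrow> nat \<Rightarrow> real" where
  "weight N \<beta> L x k = exp (- \<beta> * L (x k)) / (\<Sum>i=1..N. exp (- \<beta> * L (x i)))"

text \<open>One time step; \<open>z l\<close> is the noise in coordinate \<open>l\<close>, which is shared by all particles.\<close>
definition cbo_step ::
  "nat \<Rightarrow> real \<Rightarrow> (real^'d \<Rightarrow> real) \<Rightarrow> real \<Rightarrow> real \<Rightarrow> real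
    \<Rightarrow> (nat \<Rightarrow> real^'d) \<Rightarrow> ('d \<Rightarrow> real) \<Rightarrow> nat \<Rightarrow> real^'d" where
  "cbo_step N \<beta> L lam h \<sigma> x z i =
     x i + (lam * h) *\<^sub>R (\<Sum>k=1..N. weight N \<beta> L x k *\<^sub>R (x k - x i))
         + (\<sigma> * sqrt h) *\<^sub>R
             (\<Sum>k=1..N. \<Sum>l\<in>UNIV. (weight N \<beta> L x k * (x k $ l - x i $ l) * z l) *\<^sub>R axis l 1)"

text \<open>The recursion is only required almost surely, so measurability of the
  \<open>X n i\<close> has to be demanded for every \<open>n\<close>, not just for \<open>n = 0\<close>.\<close>
definition cbo_solution ::
  "'a measure \<Rightarrow> nat \<Rightarrow> real \<Rightarrow> (real^'d \<Rightarrow> real) \<Rightarrow> real \<Rightarrow> real \<Rightarrow> real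
    \<Rightarrow> (nat \<Rightarrow> 'd \<Rightarrow> 'a \<Rightarrow> real) \<Rightarrow> (nat \<Rightarrow> nat \<Rightarrow> 'a \<Rightarrow> real^'d) \<Rightarrow> bool" where
  "cbo_solution M N \<beta> L lam h \<sigma> Z X \<longleftrightarrow>
     (\<forall>n. \<forall>i\<in>{1..N}. X n i \<in> borel_measurable M) \<and>
     (\<forall>n. \<forall>i\<in>{1..N}. AE \<omega> in M.
        X (Suc n) i \<omega> = cbo_step N \<beta> L lam h \<sigma> (\<lambda>k. X n k \<omega>) (\<lambda>l. Z n l \<omega>) i)"

definition rate :: "real \<Rightarrow> real \<Rightarrow> real \<Rightarrow> real" where
  "rate lam h \<sigma> = 2 * lam - lam\<^sup>2 * h - \<sigma>\<^sup>2"

end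

theory Submission
  imports Defs
begin

text \<open>
  Since the weights sum to one and the noise is shared, the consensus point cancels in the
  difference of two particles, whose \<open>l\<close>-th coordinate is multiplied in each step by
  \<open>1 - \<lambda>h - \<sigma>\<surd>h Z\<^sub>n\<^sup>l\<close>, whatever the weights are. By independence from the initial
  data, parts (1) and (2) are then moment computations for a product \<open>P\<^sub>n\<^sup>l\<close> of i.i.d. factors
  of mean \<open>1 - \<lambda>h\<close> and second moment \<open>1 - hm\<close>. For part (3) no strong law of large
  numbers is needed: \<open>W\<^sub>n = e\<^sup>n\<^sup>h\<^sup>m \<Sum>\<^sub>l (P\<^sub>n\<^sup>l)\<^sup>2\<close> has bounded expectation, hence
  \<open>W\<^sub>n \<le> n\<^sup>2\<close> eventually almost surely by Borel-Cantelli, and one may take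
  \<open>Y\<^sub>n = hm/2 - ln (max 1 W\<^sub>n) / (2n)\<close>, where the maximum keeps \<open>Y\<^sub>n\<close> from exceeding its limit.
\<close>

section \<open>Products of independent affine images of standard normal variables\<close>

lemma (in prob_space) std_normal_affine_moments:
  fixes a b :: real
  assumes "distributed M lborel X std_normal_density"
  shows "integrable M (\<lambda>\<omega>. a - b * X \<omega>)" "expectation (\<lambda>\<omega>. a - b * X \<omega>) = a"
    "integrable M (\<lambda>\<omega>. (a - b * X \<omega>)\<^sup>2)" "expectation (\<lambda>\<omega>. (a - b * X \<omega>)\<^sup>2) = a\<^sup>2 + b\<^sup>2"
proof -
  have int: "integrable M X"
    using distributed_integrable[OF assms, of "\<lambda>x. x"] integrable_std_normal_moment[of 1] by simp
  have int2: "integrable M (\<lambda>\<omega>. (X \<omega>)\<^sup>2)"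
    using distributed_integrable[OF assms, of "\<lambda>x. x\<^sup>2"] integrable_std_normal_moment[of 2] by simp
  have E: "expectation X = 0"
    by (rule standard_normal_distributed_expectation[OF assms])
  have E2: "expectation (\<lambda>\<omega>. (X \<omega>)\<^sup>2) = 1"
    using standard_normal_distributed_variance[OF assms] E by simp
  have sq: "(a - b * X \<omega>)\<^sup>2 = a\<^sup>2 - 2 * a * b * X \<omega> + b\<^sup>2 * (X \<omega>)\<^sup>2" for \<omega>
    by (simp add: power2_eq_square algebra_simps)
  show "integrable M (\<lambda>\<omega>. a - b * X \<omega>)" "integrable M (\<lambda>\<omega>. (a - b * X \<omega>)\<^sup>2)"
    using int int2 by (simp_all add: sq)
  show "expectation (\<lambda>\<omega>. a - b * X \<omega>) = a" "expectation (\<lambda>\<omega>. (a - b * X \<omega>)\<^sup>2) = a\<^sup>2 + b\<^sup>2"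
    using int int2 E E2 by (simp_all add: sq prob_space)
qed

text \<open>For \<open>a = 1 - lam * h\<close> and \<open>b = \<sigma> * sqrt h\<close> this is the
  factor that coordinate \<open>l\<close> of a difference of two particles collects up to time
  \<open>n\<close>. The step from \<open>k\<close> to \<open>k + 1\<close> uses \<open>Z k\<close>,
  hence the range \<open>k < n\<close>.\<close>

definition normal_prod ::
    "real \<Rightarrow> real \<Rightarrow> (nat \<Rightarrow> 'd \<Rightarrow> 'a \<Rightarrow> real) \<Rightarrow> nat \<Rightarrow> 'd \<Rightarrow> 'a \<Rightarrow> real" where
  "normal_prod a b Z n l \<omega> = (\<Prod>k<n. a - b * Z k l \<omega>)"

lemma (in prob_space) normal_prod_moments:
  fixes a b :: real and Z :: "nat \<Rightarrow> 'd \<Rightarrow> 'a \<Rightarrow> real"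
  assumes normal: "\<And>n l. distributed M lborel (Z n l) std_normal_density"
    and indep: "indep_vars (\<lambda>_. borel) (\<lambda>(n, l). Z n l) UNIV"
  shows "integrable M (normal_prod a b Z n l)" "expectation (normal_prod a b Z n l) = a ^ n"
    "integrable M (\<lambda>\<omega>. (normal_prod a b Z n l \<omega>)\<^sup>2)"
    "expectation (\<lambda>\<omega>. (normal_prod a b Z n l \<omega>)\<^sup>2) = (a\<^sup>2 + b\<^sup>2) ^ n"
proof -
  \<comment> \<open>The noise is independent as a family over pairs, so the product over times is
    rewritten as one over \<open>{..<n} \<times> {l}\<close>. Taking \<open>f\<close> as the
    identity or the square serves both moments.\<close>
  have prod: "(\<Prod>k<n. f (a - b * Z k l \<omega>)) = (\<Prod>p\<in>{..<n} \<times> {l}. f (a - b * (case p of (k, l) \<Rightarrow> Z k l) \<omega>))"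
    for f :: "real \<Rightarrow> real" and \<omega>
  proof -
    have "{..<n} \<times> {l} = (\<lambda>k. (k, l)) ` {..<n}"
      by auto
    then show ?thesis
      by (simp add: prod.reindex inj_on_def)
  qed
  have Zl: "indep_vars (\<lambda>_. borel) (\<lambda>(n, l). Z n l) ({..<n} \<times> {l})"
    by (rule indep_vars_subset[OF indep]) simp
  have indep1: "indep_vars (\<lambda>_. borel) (\<lambda>p \<omega>. a - b * (case p of (k, l) \<Rightarrow> Z k l) \<omega>) ({..<n} \<times> {l})"
    by (rule indep_vars_compose2[OF Zl]) simp
  have indep2: "indep_vars (\<lambda>_. borel) (\<lambda>p \<omega>. (a - b * (case p of (k, l) \<Rightarrow> Z k l) \<omega>)\<^sup>2) ({..<n} \<times> {l})"
    by (rule indep_vars_compose2[OF Zl]) simp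
  note moments = std_normal_affine_moments[OF normal]
  show "integrable M (normal_prod a b Z n l)" "expectation (normal_prod a b Z n l) = a ^ n"
    using indep_vars_integrable[OF _ indep1] indep_vars_lebesgue_integral[OF _ indep1]
    by (auto simp: moments normal_prod_def[abs_def] prod[of "\<lambda>x. x"] split_beta)
  show "integrable M (\<lambda>\<omega>. (normal_prod a b Z n l \<omega>)\<^sup>2)"
    "expectation (\<lambda>\<omega>. (normal_prod a b Z n l \<omega>)\<^sup>2) = (a\<^sup>2 + b\<^sup>2) ^ n"
    using indep_vars_integrable[OF _ indep2] indep_vars_lebesgue_integral[OF _ indep2]
    by (auto simp: moments normal_prod_def prod_power_distrib prod[of "\<lambda>x. x\<^sup>2"] split_beta)
qed

section \<open>Almost sure subexponential growth\<close>

text \<open>By Markov's inequality \<open>W n\<close> reaches \<open>n\<^sup>2\<close> with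
  probability at most \<open>C / n\<^sup>2\<close>, which is summable. The threshold has to grow
  fast enough for this and slowly enough that its logarithm is negligible against
  \<open>n\<close>.\<close>

lemma (in prob_space) AE_eventually_le_square:
  fixes W :: "nat \<Rightarrow> 'a \<Rightarrow> real"
  assumes int: "\<And>n. integrable M (W n)" and nonneg: "\<And>n \<omega>. 0 \<le> W n \<omega>"
    and bound: "\<And>n. expectation (W n) \<le> C"
  shows "AE \<omega> in M. \<forall>\<^sub>F n in sequentially. W n \<omega> \<le> (real n)\<^sup>2"
proof -
  note [measurable] = borel_measurable_integrable[OF int]
  \<comment> \<open>The shift by one keeps the threshold positive, as Markov's inequality requires;
    it is undone at the end.\<close>
  define A where "A n = {\<omega> \<in> space M. W (Suc n) \<omega> \<ge> (real (Suc n))\<^sup>2}" for n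
  have meas[measurable]: "A n \<in> events" for n
    unfolding A_def by measurable
  have le: "prob (A n) \<le> C * (1 / (real (Suc n))\<^sup>2)" for n
  proof -
    have "prob (A n) \<le> expectation (W (Suc n)) / (real (Suc n))\<^sup>2"
      unfolding A_def
      by (rule integral_Markov_inequality_measure[where A = "space M"]) (use int nonneg in auto)
    also have "\<dots> \<le> C / (real (Suc n))\<^sup>2"
      by (intro divide_right_mono bound) simp
    finally show ?thesis by simp
  qed
  have "summable (\<lambda>n. 1 / (real (Suc n))\<^sup>2)"
    using inverse_squares_sums by (auto simp: sums_iff add_ac)
  then have "summable (\<lambda>n. C * (1 / (real (Suc n))\<^sup>2))"
    by (rule summable_mult)
  then have "summable (\<lambda>n. prob (A n))"
    by (rule summable_comparison_test'[where N = 0]) (use le in auto)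
  then have "AE \<omega> in M. \<forall>\<^sub>F n in sequentially. \<omega> \<in> space M - A n"
    by (intro borel_cantelli_AE1) (auto simp: less_top[symmetric])
  then show ?thesis
  proof (rule AE_mp, intro AE_I2 impI)
    fix \<omega> assume "\<forall>\<^sub>F n in sequentially. \<omega> \<in> space M - A n"
    then have "\<forall>\<^sub>F n in sequentially. W (Suc n) \<omega> \<le> (real (Suc n))\<^sup>2"
      by (rule eventually_mono) (auto simp: A_def)
    then show "\<forall>\<^sub>F n in sequentially. W n \<omega> \<le> (real n)\<^sup>2"
      by (subst (asm) eventually_sequentially_Suc)
  qed
qed

text \<open>From above, the logarithm is eventually at most \<open>2 * ln n\<close>. From below
  nothing is known about \<open>W n\<close>, which may be exponentially small or zero; the
  truncation at 1 supplies the lower bound 0.\<close>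

lemma (in prob_space) AE_ln_max_div_tendsto_0:
  fixes W :: "nat \<Rightarrow> 'a \<Rightarrow> real"
  assumes "\<And>n. integrable M (W n)" "\<And>n \<omega>. 0 \<le> W n \<omega>" "\<And>n. expectation (W n) \<le> C"
  shows "AE \<omega> in M. (\<lambda>n. ln (max 1 (W n \<omega>)) / real n) \<longlonglongrightarrow> 0"
  using AE_eventually_le_square[OF assms]
proof (rule AE_mp, intro AE_I2 impI)
  fix \<omega> assume ev: "\<forall>\<^sub>F n in sequentially. W n \<omega> \<le> (real n)\<^sup>2"
  have lim: "(\<lambda>n. 2 * (ln (real n) / real n)) \<longlonglongrightarrow> 0"
    using tendsto_mult_left[OF lim_ln_over_n, of 2] by simp
  show "(\<lambda>n. ln (max 1 (W n \<omega>)) / real n) \<longlonglongrightarrow> 0"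
  proof (rule tendsto_sandwich[OF _ _ tendsto_const lim])
    show "\<forall>\<^sub>F n in sequentially. 0 \<le> ln (max 1 (W n \<omega>)) / real n"
      by simp
    show "\<forall>\<^sub>F n in sequentially. ln (max 1 (W n \<omega>)) / real n \<le> 2 * (ln (real n) / real n)"
      \<comment> \<open>\<open>n \<ge> 1\<close> puts the other argument of the maximum, 1, below
        \<open>n\<^sup>2\<close> as well.\<close>
      using ev eventually_ge_at_top[of 1]
    proof eventually_elim
      case (elim n)
      have "max 1 (W n \<omega>) \<le> (real n)\<^sup>2"
        using elim by simp
      then have "ln (max 1 (W n \<omega>)) \<le> ln ((real n)\<^sup>2)"
        using elim by (subst ln_le_cancel_iff) auto
      also have "\<dots> = 2 * ln (real n)"
        using elim by (simp add: ln_realpow)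
      finally show ?case
        using elim by (simp add: divide_right_mono)
    qed
  qed
qed

section \<open>Differences of particles\<close>

lemma sum_weight:
  assumes "N \<ge> 1"
  shows "(\<Sum>k=1..N. weight N \<beta> L x k) = 1"
proof -
  have "(\<Sum>i=1..N. exp (- \<beta> * L (x i))) > 0"
    using assms by (intro sum_pos) auto
  then show ?thesis
    by (simp add: weight_def flip: sum_divide_distrib)
qed

lemma cbo_step_nth:
  "cbo_step N \<beta> L lam h \<sigma> x z i $ l =
     x i $ l + (lam * h + \<sigma> * sqrt h * z l) * (\<Sum>k=1..N. weight N \<beta> L x k * (x k $ l - x i $ l))"
proof -
  \<comment> \<open>Only the basis vector of index \<open>l\<close> contributes to coordinate
    \<open>l\<close>. The noise term thus contains the same weighted sum as the drift, and the two
    coefficients can be added.\<close>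
  have "(\<Sum>k=1..N. \<Sum>l\<in>UNIV. (weight N \<beta> L x k * (x k $ l - x i $ l) * z l) *\<^sub>R axis l 1) $ l
      = (\<Sum>k=1..N. weight N \<beta> L x k * (x k $ l - x i $ l)) * z l"
    by (simp add: axis_def if_distrib[of "\<lambda>u. _ * u"] sum_distrib_right cong: if_cong)
  then show ?thesis
    unfolding cbo_step_def vector_add_component vector_scaleR_component
    by (simp add: distrib_right mult_ac)
qed

lemma cbo_step_diff_nth:
  assumes "N \<ge> 1"
  shows "(cbo_step N \<beta> L lam h \<sigma> x z i - cbo_step N \<beta> L lam h \<sigma> x z j) $ l =
    (1 - lam * h - \<sigma> * sqrt h * z l) * (x i - x j) $ l"
proof -
  \<comment> \<open>Coordinate \<open>l\<close> of the consensus point. It is the same for every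
    particle and therefore drops out of the difference.\<close>
  define m where "m = (\<Sum>k=1..N. weight N \<beta> L x k * x k $ l)"
  have mean: "(\<Sum>k=1..N. weight N \<beta> L x k * (x k $ l - x i $ l)) = m - x i $ l" for i
    using sum_weight[OF assms, of \<beta> L x]
    by (simp add: m_def right_diff_distrib sum_subtractf flip: sum_distrib_right)
  then show ?thesis
    unfolding vector_minus_component cbo_step_nth mean by (simp add: algebra_simps)
qed

text \<open>The one-step factor depends neither on the weights nor on the pair of particles, so
  iterating the step only multiplies such factors. Each step adds two null sets, one per particle,
  and none depends on \<open>l\<close>.\<close>

lemma cbo_solution_diff_nth:
  assumes "N \<ge> 1" and sol: "cbo_solution M N \<beta> L lam h \<sigma> Z X" and ij: "i \<in> {1..N}" "j \<in> {1..N}"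
  shows "AE \<omega> in M. \<forall>l. (X n i \<omega> - X n j \<omega>) $ l =
    normal_prod (1 - lam * h) (\<sigma> * sqrt h) Z n l \<omega> * (X 0 i \<omega> - X 0 j \<omega>) $ l"
proof (induction n)
  case 0
  show ?case by (simp add: normal_prod_def)
next
  case (Suc n)
  have step: "AE \<omega> in M. X (Suc n) i \<omega> = cbo_step N \<beta> L lam h \<sigma> (\<lambda>k. X n k \<omega>) (\<lambda>l. Z n l \<omega>) i"
    if "i \<in> {1..N}" for i
    using sol that by (auto simp: cbo_solution_def)
  from Suc.IH step[OF ij(1)] step[OF ij(2)] show ?case
  proof eventually_elim
    case (elim \<omega>)
    then show ?case
      by (simp add: cbo_step_diff_nth[OF assms(1), unfolded vector_minus_component]
          normal_prod_def mult_ac)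
  qed
qed

section \<open>Independence of the initial differences from the noise products\<close>

lemma (in prob_space) indep_var_of_indep_rv:
  assumes "indep_rv M S f T g" and [measurable]: "F \<in> measurable S S'" "G \<in> measurable T S''"
  shows "indep_var S' (\<lambda>\<omega>. F (f \<omega>)) S'' (\<lambda>\<omega>. G (g \<omega>))"
proof -
  have [measurable]: "f \<in> measurable M S" "g \<in> measurable M T"
    and ind: "indep_set (sigma_sets (space M) {f -` A \<inter> space M | A. A \<in> sets S})
       (sigma_sets (space M) {g -` A \<inter> space M | A. A \<in> sets T})"
    using assms(1) by (auto simp: indep_rv_def)
  \<comment> \<open>Preimages under a composite are preimages under \<open>u\<close> of preimages
    under \<open>H\<close>, so the composite generates a smaller sigma-algebra; independence is
    inherited by subfamilies.\<close>
  have sub: "sigma_sets (space M) {(\<lambda>\<omega>. H (u \<omega>)) -` A \<inter> space M | A. A \<in> sets Q}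
      \<subseteq> sigma_sets (space M) {u -` A \<inter> space M | A. A \<in> sets R}"
    if u: "u \<in> measurable M R" and H: "H \<in> measurable R Q" for u H R Q
  proof (rule sigma_sets_mono', clarify)
    fix A assume "A \<in> sets Q"
    then have "H -` A \<inter> space R \<in> sets R"
      using H by (rule measurable_sets[rotated])
    moreover have "(\<lambda>\<omega>. H (u \<omega>)) -` A \<inter> space M = u -` (H -` A \<inter> space R) \<inter> space M"
      using measurable_space[OF u] by auto
    ultimately show "\<exists>B. (\<lambda>\<omega>. H (u \<omega>)) -` A \<inter> space M = u -` B \<inter> space M \<and> B \<in> sets R"
      by blast
  qed
  have "indep_set (sigma_sets (space M) {(\<lambda>\<omega>. F (f \<omega>)) -` A \<inter> space M | A. A \<in> sets S'})
       (sigma_sets (space M) {(\<lambda>\<omega>. G (g \<omega>)) -` A \<inter> space M | A. A \<in> sets S''})"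
    unfolding indep_set_def
    by (rule indep_sets_mono_sets[OF ind[unfolded indep_set_def]])
      (use sub[of f S F S'] sub[of g T G S''] in \<open>auto split: bool.split\<close>)
  then show ?thesis
    by (simp add: indep_var_eq)
qed

text \<open>The left variable is a measurable function of the joint initial configuration, the right
  one of finitely many coordinates of the noise. Joint independence matters, since the difference
  involves two particles.\<close>

lemma (in prob_space) indep_var_normal_prod_diff:
  fixes Z :: "nat \<Rightarrow> 'd::finite \<Rightarrow> 'a \<Rightarrow> real" and X :: "nat \<Rightarrow> 'a \<Rightarrow> real^'d"
  assumes "indep_rv M
           (\<Pi>\<^sub>M i\<in>I. borel) (\<lambda>\<omega>. \<lambda>i\<in>I. X i \<omega>)
           (\<Pi>\<^sub>M p\<in>UNIV. borel) (\<lambda>\<omega>. \<lambda>(n, l). Z n l \<omega>)"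
    and ij: "i \<in> I" "j \<in> I"
  shows "indep_var borel (\<lambda>\<omega>. (X i \<omega> - X j \<omega>) $ l) borel (normal_prod a b Z n l)"
proof -
  have "(\<lambda>x. (x i - x j) $ l) \<in> borel_measurable (\<Pi>\<^sub>M i\<in>I. (borel :: (real^'d) measure))"
    by (rule measurable_compose[OF borel_measurable_diff borel_measurable_nth])
      (rule measurable_component_singleton ij)+
  moreover have "(\<lambda>z. \<Prod>k<n. a - b * z (k, l)) \<in> borel_measurable
      (\<Pi>\<^sub>M p\<in>(UNIV :: (nat \<times> 'd) set). borel)"
    by measurable
  ultimately have "indep_var borel (\<lambda>\<omega>. (\<lambda>x. (x i - x j) $ l) (\<lambda>i\<in>I. X i \<omega>))
      borel (\<lambda>\<omega>. (\<lambda>z. \<Prod>k<n. a - b * z (k, l)) (\<lambda>(n, l). Z n l \<omega>))"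
    by (rule indep_var_of_indep_rv[OF assms(1)])
  then show ?thesis
    using ij by (simp add: normal_prod_def[abs_def])
qed

section \<open>First and second moments of vectors with randomly scaled coordinates\<close>

lemma power2_norm_eq_sum_nth:
  fixes x :: "real^'d"
  shows "(norm x)\<^sup>2 = (\<Sum>l\<in>UNIV. (x $ l)\<^sup>2)"
  by (simp add: norm_vec_def L2_set_def sum_nonneg)

text \<open>The expectation of a vector is taken coordinate by coordinate, so the product rule is
  applied for one \<open>l\<close> at a time. The common mean \<open>c\<close> of the factors makes
  the result a multiple of the initial expectation.\<close>

lemma (in prob_space) componentwise_scaled_expectation:
  fixes D D0 :: "'a \<Rightarrow> real^'d" and P :: "'d \<Rightarrow> 'a \<Rightarrow> real"
  assumes [measurable]: "D \<in> borel_measurable M" and D0: "integrable M D0"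
    and scaled: "AE \<omega> in M. \<forall>l. D \<omega> $ l = P l \<omega> * D0 \<omega> $ l"
    and indep: "\<And>l. indep_var borel (\<lambda>\<omega>. D0 \<omega> $ l) borel (P l)"
    and P: "\<And>l. integrable M (P l)" "\<And>l. expectation (P l) = c"
  shows "integrable M D" "expectation D = c *\<^sub>R expectation D0"
proof -
  note [measurable] = borel_measurable_integrable[OF D0] borel_measurable_integrable[OF P(1)]
  have D0l: "integrable M (\<lambda>\<omega>. D0 \<omega> $ l)" for l
    by (rule integrable_bounded_linear[OF bounded_linear_vec_nth D0])
  \<comment> \<open>A version of \<open>D\<close> satisfying the scaling identity everywhere;
    integrability and expectation are computed for \<open>F\<close> and carried over by almost sure
    equality.\<close>
  define F where "F \<omega> = (\<Sum>l\<in>UNIV. (D0 \<omega> $ l * P l \<omega>) *\<^sub>R (axis l 1 :: real^'d))" for \<omega>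
  have Fl: "F \<omega> $ l = D0 \<omega> $ l * P l \<omega>" for \<omega> l
    by (simp add: F_def axis_def if_distrib[of "\<lambda>u. _ * u"] cong: if_cong)
  have F: "integrable M F"
    unfolding F_def
    by (intro Bochner_Integration.integrable_sum integrable_scaleR_left
        indep_var_integrable[OF indep] D0l P)
  have [measurable]: "F \<in> borel_measurable M"
    using F by simp
  have eq: "AE \<omega> in M. F \<omega> = D \<omega>"
    using scaled by eventually_elim (simp add: vec_eq_iff Fl mult.commute)
  show "integrable M D"
    by (rule integrable_cong_AE_imp[OF F _ eq]) simp
  have "expectation D = expectation F"
    by (rule integral_cong_AE) (use eq in auto)
  also have "\<dots> $ l = c * expectation D0 $ l" for l
  proof -
    have "expectation F $ l = expectation (\<lambda>\<omega>. F \<omega> $ l)"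
      by (rule integral_bounded_linear[OF bounded_linear_vec_nth F, symmetric])
    also have "\<dots> = c * expectation (\<lambda>\<omega>. D0 \<omega> $ l)"
      unfolding Fl indep_var_lebesgue_integral[OF indep D0l P(1)] P(2) by simp
    also have "expectation (\<lambda>\<omega>. D0 \<omega> $ l) = expectation D0 $ l"
      by (rule integral_bounded_linear[OF bounded_linear_vec_nth D0])
    finally show ?thesis .
  qed
  ultimately show "expectation D = c *\<^sub>R expectation D0"
    by (simp add: vec_eq_iff)
qed

text \<open>The squared norm splits into squares of coordinates, and squaring both variables
  preserves independence, so the product rule applies to each summand.\<close>

lemma (in prob_space) componentwise_scaled_second_moment:
  fixes D D0 :: "'a \<Rightarrow> real^'d" and P :: "'d \<Rightarrow> 'a \<Rightarrow> real"
  assumes [measurable]: "D \<in> borel_measurable M" "D0 \<in> borel_measurable M"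
    and D0: "integrable M (\<lambda>\<omega>. (norm (D0 \<omega>))\<^sup>2)"
    and scaled: "AE \<omega> in M. \<forall>l. D \<omega> $ l = P l \<omega> * D0 \<omega> $ l"
    and indep: "\<And>l. indep_var borel (\<lambda>\<omega>. D0 \<omega> $ l) borel (P l)"
    and P: "\<And>l. integrable M (\<lambda>\<omega>. (P l \<omega>)\<^sup>2)" "\<And>l. expectation (\<lambda>\<omega>. (P l \<omega>)\<^sup>2) = q"
  shows "integrable M (\<lambda>\<omega>. (norm (D \<omega>))\<^sup>2)"
    "expectation (\<lambda>\<omega>. (norm (D \<omega>))\<^sup>2) = q * expectation (\<lambda>\<omega>. (norm (D0 \<omega>))\<^sup>2)"
proof -
  have indep': "indep_var borel (\<lambda>\<omega>. (D0 \<omega> $ l)\<^sup>2) borel (\<lambda>\<omega>. (P l \<omega>)\<^sup>2)" for l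
    using indep_var_compose[OF indep, of "\<lambda>x. x\<^sup>2" borel "\<lambda>x. x\<^sup>2" borel l] by (simp add: comp_def)
  have [measurable]: "(\<lambda>\<omega>. D0 \<omega> $ l) \<in> borel_measurable M" for l
    using indep_var_rv1[OF indep] .
  have D0l: "integrable M (\<lambda>\<omega>. (D0 \<omega> $ l)\<^sup>2)" for l
  proof (rule Bochner_Integration.integrable_bound[OF D0])
    show "AE \<omega> in M. norm ((D0 \<omega> $ l)\<^sup>2) \<le> norm ((norm (D0 \<omega>))\<^sup>2)"
      by (simp add: abs_le_square_iff[symmetric] component_le_norm_cart)
  qed measurable
  define F where "F \<omega> = (\<Sum>l\<in>UNIV. (D0 \<omega> $ l)\<^sup>2 * (P l \<omega>)\<^sup>2)" for \<omega>
  have Fl: "integrable M (\<lambda>\<omega>. (D0 \<omega> $ l)\<^sup>2 * (P l \<omega>)\<^sup>2)" for l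
    by (rule indep_var_integrable[OF indep' D0l P(1)])
  have F: "integrable M F"
    unfolding F_def by (intro Bochner_Integration.integrable_sum Fl)
  have [measurable]: "F \<in> borel_measurable M"
    using F by simp
  have eq: "AE \<omega> in M. F \<omega> = (norm (D \<omega>))\<^sup>2"
    using scaled by eventually_elim (simp add: power2_norm_eq_sum_nth F_def power_mult_distrib mult.commute)
  show "integrable M (\<lambda>\<omega>. (norm (D \<omega>))\<^sup>2)"
    by (rule integrable_cong_AE_imp[OF F _ eq]) simp
  have "expectation (\<lambda>\<omega>. (norm (D \<omega>))\<^sup>2) = expectation F"
    by (rule integral_cong_AE) (use eq in auto)
  also have "\<dots> = (\<Sum>l\<in>UNIV. expectation (\<lambda>\<omega>. (D0 \<omega> $ l)\<^sup>2) * q)"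
    unfolding F_def Bochner_Integration.integral_sum[OF Fl]
    by (simp add: indep_var_lebesgue_integral[OF indep' D0l P(1)] P(2))
  also have "\<dots> = q * expectation (\<lambda>\<omega>. (norm (D0 \<omega>))\<^sup>2)"
    unfolding power2_norm_eq_sum_nth
    by (simp add: Bochner_Integration.integral_sum[OF D0l] sum_distrib_left mult.commute)
  finally show "expectation (\<lambda>\<omega>. (norm (D \<omega>))\<^sup>2) = q * expectation (\<lambda>\<omega>. (norm (D0 \<omega>))\<^sup>2)" .
qed

section \<open>The random exponential rate\<close>

lemma (in prob_space) normal_prod_decay_rate:
  fixes Z :: "nat \<Rightarrow> 'd::finite \<Rightarrow> 'a \<Rightarrow> real"
  assumes normal: "\<And>n l. distributed M lborel (Z n l) std_normal_density"
    and indep: "indep_vars (\<lambda>_. borel) (\<lambda>(n, l). Z n l) UNIV"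
    and le: "a\<^sup>2 + b\<^sup>2 \<le> exp (- 2 * c)"
  obtains Y :: "nat \<Rightarrow> 'a \<Rightarrow> real"
  where "\<And>n. Y n \<in> borel_measurable M"
    and "\<And>n l \<omega>. n \<ge> 1 \<Longrightarrow> \<bar>normal_prod a b Z n l \<omega>\<bar> \<le> exp (- real n * Y n \<omega>)"
    and "AE \<omega> in M. (\<lambda>n. Y n \<omega>) \<longlonglongrightarrow> c"
proof
  define P where "P = normal_prod a b Z"
  \<comment> \<open>The exponential compensates the decay of the second moments. Summing over
    \<open>l\<close> lets one \<open>Y\<close> control all coordinates.\<close>
  define W where "W n \<omega> = exp (2 * real n * c) * (\<Sum>l\<in>UNIV. (P n l \<omega>)\<^sup>2)" for n \<omega>
  \<comment> \<open>Chosen so that \<open>exp (- 2 * n * Y n)\<close> equals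
    \<open>exp (- 2 * n * c) * max 1 (W n)\<close> for \<open>n \<ge> 1\<close>. The products may
    decay faster than at rate \<open>c\<close>; the truncation discards this surplus, so that the
    limit is exactly \<open>c\<close>.\<close>
  define Y where "Y n \<omega> = c - ln (max 1 (W n \<omega>)) / real n / 2" for n \<omega>
  note moments = normal_prod_moments[OF normal indep, of a b, folded P_def]
  have W: "integrable M (W n)" for n
    unfolding W_def
    by (intro integrable_mult_right Bochner_Integration.integrable_sum moments)
  have W_nonneg: "0 \<le> W n \<omega>" for n \<omega>
    by (simp add: W_def sum_nonneg)
  have W_le: "expectation (W n) \<le> CARD('d)" for n
  proof -
    have "expectation (W n) = exp (2 * real n * c) * (CARD('d) * (a\<^sup>2 + b\<^sup>2) ^ n)"
      by (simp add: W_def[abs_def] moments Bochner_Integration.integral_sum)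
    also have "\<dots> \<le> exp (2 * real n * c) * (CARD('d) * exp (- 2 * c) ^ n)"
      by (intro mult_left_mono power_mono le) auto
    also have "\<dots> = CARD('d)"
      by (simp add: exp_of_nat_mult[symmetric] mult_exp_exp mult_ac)
    finally show ?thesis .
  qed
  show "Y n \<in> borel_measurable M" for n
    using borel_measurable_integrable[OF W, measurable] unfolding Y_def by measurable
  show "AE \<omega> in M. (\<lambda>n. Y n \<omega>) \<longlonglongrightarrow> c"
  proof -
    have "AE \<omega> in M. (\<lambda>n. ln (max 1 (W n \<omega>)) / real n) \<longlonglongrightarrow> 0"
      by (rule AE_ln_max_div_tendsto_0[OF W W_nonneg W_le])
    then show ?thesis
    proof eventually_elim
      case (elim \<omega>)
      have "(\<lambda>n. Y n \<omega>) \<longlonglongrightarrow> c - 0 / 2"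
        unfolding Y_def by (intro tendsto_intros elim) simp
      then show ?case by simp
    qed
  qed
  show "\<bar>normal_prod a b Z n l \<omega>\<bar> \<le> exp (- real n * Y n \<omega>)" if "n \<ge> 1" for n l \<omega>
  proof (rule power2_le_imp_le)
    have "\<bar>P n l \<omega>\<bar>\<^sup>2 \<le> (\<Sum>l\<in>UNIV. (P n l \<omega>)\<^sup>2)"
      by (auto intro: member_le_sum)
    also have "\<dots> = exp (- 2 * real n * c) * W n \<omega>"
      by (simp add: W_def mult_exp_exp flip: mult.assoc)
    \<comment> \<open>The maximum is positive even where \<open>W n\<close> vanishes, so it can be
      written as the exponential of its logarithm.\<close>
    also have "\<dots> \<le> exp (- 2 * real n * c) * max 1 (W n \<omega>)"
      by simp
    also have "\<dots> = exp (- 2 * real n * c + ln (max 1 (W n \<omega>)))"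
      unfolding exp_add by (simp add: max_def)
    also have "- 2 * real n * c + ln (max 1 (W n \<omega>)) = 2 * (- real n * Y n \<omega>)"
      using that by (simp add: Y_def field_simps)
    also have "exp \<dots> = (exp (- real n * Y n \<omega>))\<^sup>2"
      by (simp only: exp_double)
    finally show "\<bar>normal_prod a b Z n l \<omega>\<bar>\<^sup>2 \<le> (exp (- real n * Y n \<omega>))\<^sup>2"
      by (simp add: P_def)
  qed simp
qed

section \<open>Moment bounds and pathwise bound for the particle system\<close>

theorem theorem3p4:
  fixes M :: "'a measure"
    and N :: nat
    and \<beta> lam h \<sigma> :: real
    and L :: "real^'d \<Rightarrow> real"
    and Z :: "nat \<Rightarrow> 'd \<Rightarrow> 'a \<Rightarrow> real"
    and X :: "nat \<Rightarrow> nat \<Rightarrow> 'a \<Rightarrow> real^'d"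
  assumes "prob_space M"
    and "N \<ge> 1"
    and "\<beta> > 0"
    and "locally_lipschitz L"
    and "\<And>n l. distributed M lborel (Z n l) std_normal_density"
    and "prob_space.indep_vars M (\<lambda>_. borel) (\<lambda>(n, l). Z n l) (UNIV :: (nat \<times> 'd) set)"
    and "indep_rv M
           (\<Pi>\<^sub>M i\<in>{1..N}. borel) (\<lambda>\<omega>. \<lambda>i\<in>{1..N}. X 0 i \<omega>)
           (\<Pi>\<^sub>M p\<in>(UNIV :: (nat \<times> 'd) set). borel) (\<lambda>\<omega>. \<lambda>(n, l). Z n l \<omega>)"
    and "cbo_solution M N \<beta> L lam h \<sigma> Z X"
  shows
    "(\<sigma> > 0 \<and> lam > 0 \<and> 0 < h \<and> h < 1 / lam \<and>
        (\<forall>i\<in>{1..N}. integrable M (\<lambda>\<omega>. norm (X 0 i \<omega>))) \<longrightarrow>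
        (\<forall>i\<in>{1..N}. \<forall>j\<in>{1..N}. \<forall>n.
           integrable M (\<lambda>\<omega>. X n i \<omega> - X n j \<omega>) \<and>
           norm (\<integral>\<omega>. X n i \<omega> - X n j \<omega> \<partial>M)
             \<le> exp (- lam * real n * h) * norm (\<integral>\<omega>. X 0 i \<omega> - X 0 j \<omega> \<partial>M)))
     \<and>
     (\<sigma> > 0 \<and> 2 * lam > \<sigma>\<^sup>2 \<and> 0 < h \<and> h < (2 * lam - \<sigma>\<^sup>2) / lam\<^sup>2 \<and>
        (\<forall>i\<in>{1..N}. integrable M (\<lambda>\<omega>. (norm (X 0 i \<omega>))\<^sup>2)) \<longrightarrow>
        (\<forall>i\<in>{1..N}. \<forall>j\<in>{1..N}. \<forall>n.
           integrable M (\<lambda>\<omega>. (norm (X n i \<omega> - X n j \<omega>))\<^sup>2) \<and>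
           (\<integral>\<omega>. (norm (X n i \<omega> - X n j \<omega>))\<^sup>2 \<partial>M)
             \<le> exp (- real n * h * rate lam h \<sigma>) * (\<integral>\<omega>. (norm (X 0 i \<omega> - X 0 j \<omega>))\<^sup>2 \<partial>M)))
     \<and>
     (\<sigma> > 0 \<and> 2 * lam > \<sigma>\<^sup>2 \<and> 0 < h \<and> h < (2 * lam - \<sigma>\<^sup>2) / lam\<^sup>2 \<longrightarrow>
        (\<exists>Y :: nat \<Rightarrow> 'a \<Rightarrow> real.
           (\<forall>n\<ge>1. Y n \<in> borel_measurable M) \<and>
           (\<forall>i\<in>{1..N}. \<forall>j\<in>{1..N}. \<forall>n\<ge>1. AE \<omega> in M.
              norm (X n i \<omega> - X n j \<omega>) \<le> exp (- real n * Y n \<omega>) * norm (X 0 i \<omega> - X 0 j \<omega>)) \<and>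
           (AE \<omega> in M. (\<lambda>n. Y n \<omega>) \<longlonglongrightarrow> h * rate lam h \<sigma> / 2)) \<and>
        h * rate lam h \<sigma> / 2 > 0)"
proof -
  interpret prob_space M by fact
  note normal = assms(5) and indep = assms(6)
  define a where "a = 1 - lam * h"
  define b where "b = \<sigma> * sqrt h"
  note moments = normal_prod_moments[OF normal indep, of a b]
  have X[measurable]: "X n i \<in> borel_measurable M" if "i \<in> {1..N}" for n i
    using assms(8) that by (auto simp: cbo_solution_def)
  have diff: "AE \<omega> in M. \<forall>l. (X n i \<omega> - X n j \<omega>) $ l =
      normal_prod a b Z n l \<omega> * (X 0 i \<omega> - X 0 j \<omega>) $ l"
    if "i \<in> {1..N}" "j \<in> {1..N}" for n i j
    unfolding a_def b_def by (rule cbo_solution_diff_nth[OF assms(2,8) that])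
  note indep0 = indep_var_normal_prod_diff[OF assms(7), of _ _ _ a b]
  have q: "a\<^sup>2 + b\<^sup>2 = 1 - h * rate lam h \<sigma>" if "0 < h"
    using that by (simp add: a_def b_def rate_def power_mult_distrib power2_eq_square algebra_simps)
  \<comment> \<open>The inequality \<open>1 - x \<le> exp (- x)\<close> with
    \<open>x = h * rate lam h \<sigma>\<close>.\<close>
  have q_le: "a\<^sup>2 + b\<^sup>2 \<le> exp (- (h * rate lam h \<sigma>))" if "0 < h"
    using exp_ge_add_one_self[of "- (h * rate lam h \<sigma>)"] q[OF that] by simp
  have part1: "integrable M (\<lambda>\<omega>. X n i \<omega> - X n j \<omega>) \<and>
      norm (\<integral>\<omega>. X n i \<omega> - X n j \<omega> \<partial>M) \<le> exp (- lam * real n * h) * norm (\<integral>\<omega>. X 0 i \<omega> - X 0 j \<omega> \<partial>M)"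
    if "lam > 0" "h < 1 / lam" and int: "\<forall>i\<in>{1..N}. integrable M (\<lambda>\<omega>. norm (X 0 i \<omega>))"
      and ij: "i \<in> {1..N}" "j \<in> {1..N}" for i j n
  proof -
    have D[measurable]: "(\<lambda>\<omega>. X n i \<omega> - X n j \<omega>) \<in> borel_measurable M" for n
      using X[OF ij(1)] X[OF ij(2)] by measurable
    have D0: "integrable M (\<lambda>\<omega>. X 0 i \<omega> - X 0 j \<omega>)"
      using int ij X by (intro Bochner_Integration.integrable_diff) (auto simp: integrable_norm_iff)
    note E = componentwise_scaled_expectation[OF D D0 diff[OF ij, of n] indep0[OF ij] moments(1,2)]
    \<comment> \<open>This makes \<open>a\<close> positive, so that \<open>\<bar>a\<bar>\<close> is
      \<open>1 - lam * h\<close> and is bounded by \<open>exp (- (lam * h))\<close>.\<close>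
    have "lam * h < 1"
      using that by (simp add: field_simps)
    then have "\<bar>a ^ n\<bar> \<le> exp (- (lam * h)) ^ n"
      using exp_ge_add_one_self[of "- (lam * h)"]
      by (simp add: a_def power_abs power_mono)
    also have "\<dots> = exp (- lam * real n * h)"
      by (simp add: exp_of_nat_mult[symmetric] mult_ac)
    finally show ?thesis
      using E by (simp add: mult_right_mono)
  qed
  have part2: "integrable M (\<lambda>\<omega>. (norm (X n i \<omega> - X n j \<omega>))\<^sup>2) \<and>
      (\<integral>\<omega>. (norm (X n i \<omega> - X n j \<omega>))\<^sup>2 \<partial>M)
        \<le> exp (- real n * h * rate lam h \<sigma>) * (\<integral>\<omega>. (norm (X 0 i \<omega> - X 0 j \<omega>))\<^sup>2 \<partial>M)"
    if "0 < h" and int: "\<forall>i\<in>{1..N}. integrable M (\<lambda>\<omega>. (norm (X 0 i \<omega>))\<^sup>2)"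
      and ij: "i \<in> {1..N}" "j \<in> {1..N}" for i j n
  proof -
    have D[measurable]: "(\<lambda>\<omega>. X n i \<omega> - X n j \<omega>) \<in> borel_measurable M" for n
      using X[OF ij(1)] X[OF ij(2)] by measurable
    have D0: "integrable M (\<lambda>\<omega>. (norm (X 0 i \<omega> - X 0 j \<omega>))\<^sup>2)"
    proof (rule Bochner_Integration.integrable_bound)
      show "integrable M (\<lambda>\<omega>. 2 * (norm (X 0 i \<omega>))\<^sup>2 + 2 * (norm (X 0 j \<omega>))\<^sup>2)"
        using int ij by simp
      \<comment> \<open>The parallelogram identity: dropping the term with \<open>x + y\<close>
        bounds the squared difference by an integrable function.\<close>
      have "(norm (x - y))\<^sup>2 + (norm (x + y))\<^sup>2 = 2 * (norm x)\<^sup>2 + 2 * (norm y)\<^sup>2" for x y :: "real^'d"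
        by (simp add: power2_norm_eq_inner inner_simps inner_commute)
      then have "(norm (x - y))\<^sup>2 \<le> 2 * (norm x)\<^sup>2 + 2 * (norm y)\<^sup>2" for x y :: "real^'d"
        using zero_le_power2[of "norm (x + y)"] by (metis le_add_same_cancel1)
      then show "AE \<omega> in M. norm ((norm (X 0 i \<omega> - X 0 j \<omega>))\<^sup>2)
          \<le> norm (2 * (norm (X 0 i \<omega>))\<^sup>2 + 2 * (norm (X 0 j \<omega>))\<^sup>2)"
        by simp
    qed measurable
    note E = componentwise_scaled_second_moment
      [OF D D D0 diff[OF ij, of n] indep0[OF ij] moments(3,4)]
    have "(a\<^sup>2 + b\<^sup>2) ^ n \<le> exp (- (h * rate lam h \<sigma>)) ^ n"
      by (intro power_mono q_le that) simp
    also have "\<dots> = exp (- real n * h * rate lam h \<sigma>)"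
      by (simp add: exp_of_nat_mult[symmetric] mult_ac)
    finally show ?thesis
      using E by (simp add: mult_right_mono)
  qed
  have part3: "\<exists>Y :: nat \<Rightarrow> 'a \<Rightarrow> real.
      (\<forall>n\<ge>1. Y n \<in> borel_measurable M) \<and>
      (\<forall>i\<in>{1..N}. \<forall>j\<in>{1..N}. \<forall>n\<ge>1. AE \<omega> in M.
         norm (X n i \<omega> - X n j \<omega>) \<le> exp (- real n * Y n \<omega>) * norm (X 0 i \<omega> - X 0 j \<omega>)) \<and>
      (AE \<omega> in M. (\<lambda>n. Y n \<omega>) \<longlonglongrightarrow> h * rate lam h \<sigma> / 2)"
    if "0 < h"
  proof -
    \<comment> \<open>The rate \<open>c\<close> is half of \<open>h * rate lam h \<sigma>\<close>,
      because the second moment governs the square of the distance.\<close>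
    have "a\<^sup>2 + b\<^sup>2 \<le> exp (- 2 * (h * rate lam h \<sigma> / 2))"
      using q_le[OF that] by simp
    from normal_prod_decay_rate[OF normal indep this] obtain Y
      where Y: "\<And>n. Y n \<in> borel_measurable M"
        "\<And>n l \<omega>. n \<ge> 1 \<Longrightarrow> \<bar>normal_prod a b Z n l \<omega>\<bar> \<le> exp (- real n * Y n \<omega>)"
        "AE \<omega> in M. (\<lambda>n. Y n \<omega>) \<longlonglongrightarrow> h * rate lam h \<sigma> / 2"
      by blast
    have "AE \<omega> in M. norm (X n i \<omega> - X n j \<omega>) \<le> exp (- real n * Y n \<omega>) * norm (X 0 i \<omega> - X 0 j \<omega>)"
      if ij: "i \<in> {1..N}" "j \<in> {1..N}" and "n \<ge> 1" for i j n
      using diff[OF ij, of n]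
    proof eventually_elim
      case (elim \<omega>)
      \<comment> \<open>The coordinates carry different factors, all bounded by the same
        exponential, so the norms compare coordinatewise. The estimate is pathwise, with one
        \<open>Y\<close> for all pairs of particles.\<close>
      have "norm (X n i \<omega> - X n j \<omega>) \<le> norm (exp (- real n * Y n \<omega>) *\<^sub>R (X 0 i \<omega> - X 0 j \<omega>))"
      proof (rule norm_le_componentwise_cart)
        fix l
        show "norm ((X n i \<omega> - X n j \<omega>) $ l) \<le> norm ((exp (- real n * Y n \<omega>) *\<^sub>R (X 0 i \<omega> - X 0 j \<omega>)) $ l)"
          unfolding elim[rule_format] vector_scaleR_component
          using Y(2)[OF \<open>n \<ge> 1\<close>, of l \<omega>] by (simp add: abs_mult mult_right_mono)
      qed
      then show ?case by simp
    qed
    with Y(1,3) show ?thesis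
      by (intro exI[of _ Y]) simp
  qed
  have rate_pos: "h * rate lam h \<sigma> / 2 > 0"
    if "\<sigma> > 0" "2 * lam > \<sigma>\<^sup>2" "0 < h" "h < (2 * lam - \<sigma>\<^sup>2) / lam\<^sup>2"
  proof -
    \<comment> \<open>Positivity of \<open>lam\<close> allows multiplying the bound on
      \<open>h\<close> by \<open>lam\<^sup>2\<close>, which turns it into positivity of the
      rate.\<close>
    have "0 < lam"
      using that zero_le_power2[of \<sigma>] by linarith
    then have "0 < rate lam h \<sigma>"
      using that by (simp add: rate_def field_simps)
    with that show ?thesis by simp
  qed
  show ?thesis
  proof (intro conjI[OF _ conjI] impI; elim conjE)
    assume "0 < lam" "0 < h" "h < 1 / lam" "\<forall>i\<in>{1..N}. integrable M (\<lambda>\<omega>. norm (X 0 i \<omega>))"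
    then show "\<forall>i\<in>{1..N}. \<forall>j\<in>{1..N}. \<forall>n. integrable M (\<lambda>\<omega>. X n i \<omega> - X n j \<omega>) \<and>
           norm (\<integral>\<omega>. X n i \<omega> - X n j \<omega> \<partial>M)
             \<le> exp (- lam * real n * h) * norm (\<integral>\<omega>. X 0 i \<omega> - X 0 j \<omega> \<partial>M)"
      by (intro ballI allI part1) auto
  next
    assume "0 < h" "\<forall>i\<in>{1..N}. integrable M (\<lambda>\<omega>. (norm (X 0 i \<omega>))\<^sup>2)"
    then show "\<forall>i\<in>{1..N}. \<forall>j\<in>{1..N}. \<forall>n. integrable M (\<lambda>\<omega>. (norm (X n i \<omega> - X n j \<omega>))\<^sup>2) \<and>
           (\<integral>\<omega>. (norm (X n i \<omega> - X n j \<omega>))\<^sup>2 \<partial>M)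
             \<le> exp (- real n * h * rate lam h \<sigma>) * (\<integral>\<omega>. (norm (X 0 i \<omega> - X 0 j \<omega>))\<^sup>2 \<partial>M)"
      by (intro ballI allI part2) auto
  qed (intro conjI[OF part3 rate_pos])
qed

end
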